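(* Let $G$ be a homogeneous chordal graph on $n$ nodes. Then a minimal polynomial for $\mathcal{S}^*(G)$ has degree no larger than $\left\lceil \frac{n+1}{2}\right\rceil\left\lfloor\frac{n+1}{2}\right\rfloor$.
   Context: Graphs are finite, simple and undirected. A graph is homogeneous chordal if it is chordal (every cycle of length at least 4 has a chord) and has no induced subgraph isomorphic to a path on 4 nodes. $\mathcal{S}^n$ is the space of real symmetric $n\times n$ matrices. For a graph $G$ with vertices $\{1,\dots,n\}$ and edge set $E$, put $\mathcal{S}(G)=\{X\in\mathcal{S}^n \mid X_{ij}=0 \text{ for all } i\neq j \text{ with } \{i,j\}\notin E\}$ and $\mathcal{S}^*(G)=\{A\in\mathcal{S}(G)\mid A_C\succeq 0 \text{ for all cliques } C \text{ of } G\}$, where $A_C$ is the principal submatrix indexed by the vertices of $C$. The ambient space of $\mathcal{S}^*(G)$ is $\mathcal{S}(G)$. A minimal polynomial of a closed semialgebraic convex cone $K\subsetneq\mathcal{V}$ with nonempty interior in the finite-dimensional real space $\mathcal{V}$ is a nonzero polynomial on $\mathcal{V}$ of minimal degree vanishing on the boundary of $K$ (it is unique up to scaling and divides every polynomial vanishing on the boundary). *)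

theory Defs
  imports "HOL-Analysis.Analysis" "HOL-Library.Poly_Mapping"
begin

text \<open>
  The vertex set of a graph is a finite type \<open>'n\<close> (so there are \<open>CARD('n)\<close> nodes), and the
  graph is given by its set of edges, an edge being a two-element set of vertices.
\<close>

definition simple_graph :: "'n set set \<Rightarrow> bool" where
  "simple_graph E \<longleftrightarrow> (\<forall>e\<in>E. card e = 2)"

definition clique :: "'n set set \<Rightarrow> 'n set \<Rightarrow> bool" where
  "clique E C \<longleftrightarrow> (\<forall>i\<in>C. \<forall>j\<in>C. i \<noteq> j \<longrightarrow> {i, j} \<in> E)"

definition cycle_edges :: "'n list \<Rightarrow> 'n set set" where
  "cycle_edges vs = {{vs ! k, vs ! (Suc k mod length vs)} | k. k < length vs}"

definition cycle :: "'n set set \<Rightarrow> 'n list \<Rightarrow> bool" where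
  "cycle E vs \<longleftrightarrow> 3 \<le> length vs \<and> distinct vs \<and> cycle_edges vs \<subseteq> E"

definition chord :: "'n set set \<Rightarrow> 'n list \<Rightarrow> 'n set \<Rightarrow> bool" where
  "chord E vs e \<longleftrightarrow> e \<in> E \<and> e \<subseteq> set vs \<and> e \<notin> cycle_edges vs"

definition chordal :: "'n set set \<Rightarrow> bool" where
  "chordal E \<longleftrightarrow> (\<forall>vs. cycle E vs \<and> 4 \<le> length vs \<longrightarrow> (\<exists>e. chord E vs e))"

text \<open>The map \<open>f\<close> is an isomorphism from the path with nodes \<open>0, \<dots>, k - 1\<close> onto an induced subgraph.\<close>

definition has_induced_path :: "nat \<Rightarrow> 'n set set \<Rightarrow> bool" where
  "has_induced_path k E \<longleftrightarrow>
     (\<exists>f :: nat \<Rightarrow> 'n. inj_on f {..<k} \<and>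
        (\<forall>i<k. \<forall>j<k. {f i, f j} \<in> E \<longleftrightarrow> j = Suc i \<or> i = Suc j))"

definition homogeneous_chordal :: "'n set set \<Rightarrow> bool" where
  "homogeneous_chordal E \<longleftrightarrow> chordal E \<and> \<not> has_induced_path 4 E"

definition sym_matrices_on :: "'n set set \<Rightarrow> (real ^ 'n ^ 'n) set" where
  "sym_matrices_on E =
     {X. transpose X = X \<and> (\<forall>i j. i \<noteq> j \<and> {i, j} \<notin> E \<longrightarrow> X $ i $ j = 0)}"

text \<open>Positive semidefiniteness of the principal submatrix with rows and columns indexed by \<open>C\<close>.\<close>

definition psd_on :: "'n set \<Rightarrow> real ^ 'n ^ 'n \<Rightarrow> bool" where
  "psd_on C A \<longleftrightarrow>
     (\<forall>i\<in>C. \<forall>j\<in>C. A $ i $ j = A $ j $ i) \<and>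
     (\<forall>x :: 'n \<Rightarrow> real. 0 \<le> (\<Sum>i\<in>C. \<Sum>j\<in>C. x i * A $ i $ j * x j))"

definition clique_psd_cone :: "'n set set \<Rightarrow> (real ^ 'n ^ 'n) set" where
  "clique_psd_cone E = {A \<in> sym_matrices_on E. \<forall>C. clique E C \<longrightarrow> psd_on C A}"

text \<open>Formal multivariate polynomials: finitely supported maps from monomials to coefficients,
  a monomial being a finitely supported map from variables to exponents.\<close>

type_synonym 'v mpoly = "('v \<Rightarrow>\<^sub>0 nat) \<Rightarrow>\<^sub>0 real"

definition mpoly_vars :: "'v mpoly \<Rightarrow> 'v set" where
  "mpoly_vars p = (\<Union>m\<in>Poly_Mapping.keys p. Poly_Mapping.keys m)"

definition mpoly_eval :: "('v \<Rightarrow> real) \<Rightarrow> 'v mpoly \<Rightarrow> real" where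
  "mpoly_eval a p =
     (\<Sum>m\<in>Poly_Mapping.keys p.
        Poly_Mapping.lookup p m * (\<Prod>v\<in>Poly_Mapping.keys m. a v ^ Poly_Mapping.lookup m v))"

definition total_degree :: "'v mpoly \<Rightarrow> nat" where
  "total_degree p =
     Max (insert 0
       ((\<lambda>m. \<Sum>v\<in>Poly_Mapping.keys m. Poly_Mapping.lookup m v) ` Poly_Mapping.keys p))"

text \<open>
  A polynomial on a finite-dimensional real vector space with basis \<open>B\<close> is a polynomial whose
  variables are the elements of \<open>B\<close>; its value at \<open>x\<close> is obtained by substituting for each
  \<open>b\<close> in \<open>B\<close> the coordinate of \<open>x\<close> along \<open>b\<close>. The ambient space of \<open>K\<close> is \<open>span B\<close>, and the
  boundary of \<open>K\<close> is taken in that space.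
\<close>

definition vanishes_on_boundary ::
    "'a::euclidean_space set \<Rightarrow> 'a set \<Rightarrow> 'a mpoly \<Rightarrow> bool" where
  "vanishes_on_boundary B K p \<longleftrightarrow>
     (\<forall>x \<in> top_of_set (span B) frontier_of K. mpoly_eval (representation B x) p = 0)"

definition minimal_polynomial ::
    "'a::euclidean_space set \<Rightarrow> 'a set \<Rightarrow> 'a mpoly \<Rightarrow> bool" where
  "minimal_polynomial B K p \<longleftrightarrow>
     p \<noteq> 0 \<and> mpoly_vars p \<subseteq> B \<and> vanishes_on_boundary B K p \<and>
     (\<forall>q. q \<noteq> 0 \<and> mpoly_vars q \<subseteq> B \<and> vanishes_on_boundary B K q \<longrightarrow>
        total_degree p \<le> total_degree q)"

end

theory Submission
  imports Defs
begin

text \<open>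
  The polynomial is the product over the maximal cliques \<open>C\<close> of the determinants of the principal
  submatrices \<open>A\<^sub>C\<close>. It vanishes on the boundary because a point of the cone at which all
  the \<open>A\<^sub>C\<close> are nonsingular has all the \<open>A\<^sub>C\<close> positive definite, hence is interior, and it is
  not zero because its value at the identity matrix is 1.

  Its degree is the sum of the sizes of the maximal cliques. In a homogeneous chordal graph the
  closed neighbourhoods of adjacent vertices are nested, so that every maximal clique is the closed
  neighbourhood of one of its vertices. If \<open>\<omega>\<close> is the largest clique size, a vertex thus chosen for
  another maximal clique lies outside a clique of size \<open>\<omega>\<close>; so there are at most \<open>n - \<omega> + 1\<close> maximal
  cliques, and the degree is at most \<open>\<omega> (n + 1 - \<omega>)\<close>.
\<close>

section \<open>Maximal cliques\<close>

definition max_cliques :: "'n set set \<Rightarrow> 'n set set" where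
  "max_cliques E = {C. clique E C \<and> (\<forall>D. clique E D \<and> C \<subseteq> D \<longrightarrow> D = C)}"

definition closed_nbhd :: "'n set set \<Rightarrow> 'n \<Rightarrow> 'n set" where
  "closed_nbhd E v = insert v {w. {v, w} \<in> E}"

lemma clique_subset_max_clique:
  fixes E :: "'n::finite set set"
  assumes "clique E C"
  shows "\<exists>D\<in>max_cliques E. C \<subseteq> D"
proof -
  have "finite {D. clique E D}" "C \<in> {D. clique E D}"
    using assms by auto
  from finite_has_maximal2[OF this] show ?thesis
    unfolding max_cliques_def by auto
qed

text \<open>If \<open>u\<close> and \<open>v\<close> had private neighbours \<open>x\<close> and
  \<open>y\<close>, the sequence x, u, v, y would be a chordless 4-cycle when \<open>x\<close> and
  \<open>y\<close> are adjacent, and an induced path on 4 nodes otherwise.\<close>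

lemma closed_nbhd_nested:
  assumes "simple_graph E" "homogeneous_chordal E" "{u, v} \<in> E"
  shows "closed_nbhd E u \<subseteq> closed_nbhd E v \<or> closed_nbhd E v \<subseteq> closed_nbhd E u"
proof (rule ccontr)
  assume "\<not> ?thesis"
  then obtain x y where x: "x \<in> closed_nbhd E u" "x \<notin> closed_nbhd E v"
    and y: "y \<in> closed_nbhd E v" "y \<notin> closed_nbhd E u"
    by blast
  have loop: "{a, a} \<notin> E" for a
    using assms(1) unfolding simple_graph_def by (force dest: bspec)
  have edges: "{x, u} \<in> E" "{v, y} \<in> E" "{u, v} \<in> E"
    and nonedges: "{x, v} \<notin> E" "{u, y} \<notin> E"
    and neq: "x \<noteq> u" "x \<noteq> v" "y \<noteq> u" "y \<noteq> v" "u \<noteq> v"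
    using x y assms(3) loop unfolding closed_nbhd_def by (auto simp: insert_commute)
  have "x \<noteq> y"
    using edges nonedges by (auto simp: insert_commute)
  show False
  proof (cases "{x, y} \<in> E")
    case True
    have ce: "cycle_edges [x, u, v, y] = {{x, u}, {u, v}, {v, y}, {y, x}}"
    proof -
      have "cycle_edges vs = (\<lambda>k. {vs ! k, vs ! (Suc k mod length vs)}) ` {..<length vs}"
        for vs :: "'a list"
        unfolding cycle_edges_def by blast
      then show ?thesis
        by (simp add: lessThan_Suc insert_commute)
    qed
    have "{y, x} \<in> E"
      using True by (simp add: insert_commute)
    then have "cycle E [x, u, v, y]"
      unfolding cycle_def ce using edges neq \<open>x \<noteq> y\<close> by simp
    then have "\<exists>e. chord E [x, u, v, y] e"
      using assms(2) unfolding homogeneous_chordal_def chordal_def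
      by (elim conjE allE[of _ "[x, u, v, y]"]) simp
    then obtain e where e: "e \<in> E" "e \<subseteq> {x, u, v, y}" "e \<notin> {{x, u}, {u, v}, {v, y}, {y, x}}"
      unfolding chord_def ce by auto
    from e(1) assms(1) obtain a b where ab: "e = {a, b}" "a \<noteq> b"
      unfolding simple_graph_def by (auto dest!: bspec simp: card_2_iff)
    \<comment> \<open>Of the six pairs of vertices four are cycle edges; only the two diagonals
      remain, and both are non-edges.\<close>
    then have "e = {x, v} \<or> e = {u, y}"
      using e(2,3) by (auto simp: doubleton_eq_iff)
    with e(1) nonedges show False
      by blast
  next
    case False
    define f where "f = (\<lambda>k. [x, u, v, y] ! k)"
    have less4: "k < 4 \<longleftrightarrow> k = 0 \<or> k = 1 \<or> k = 2 \<or> k = 3" for k :: nat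
      by auto
    have f: "f 0 = x" "f (Suc 0) = u" "f 2 = v" "f 3 = y"
      by (auto simp: f_def numeral_eq_Suc)
    have "inj_on f {..<4}"
      unfolding f_def using neq \<open>x \<noteq> y\<close> by (intro inj_on_nth) auto
    moreover have "{f i, f j} \<in> E \<longleftrightarrow> j = Suc i \<or> i = Suc j" if "i < 4" "j < 4" for i j
    proof -
      have "{u, x} \<in> E" "{y, v} \<in> E" "{v, u} \<in> E" "{v, x} \<notin> E" "{y, u} \<notin> E" "{y, x} \<notin> E"
        using False edges nonedges by (simp_all add: insert_commute)
      with that False edges nonedges loop[of x] loop[of y] loop[of u] loop[of v] show ?thesis
        unfolding less4 by (elim disjE) (simp_all add: f)
    qed
    ultimately have "has_induced_path 4 E"
      unfolding has_induced_path_def by blast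
    with assms(2) show False
      unfolding homogeneous_chordal_def by blast
  qed
qed

text \<open>Take \<open>v\<close> in \<open>C\<close> with inclusion-minimal closed neighbourhood.
  By nestedness this neighbourhood lies in that of every member of \<open>C\<close>, so a neighbour
  of \<open>v\<close> is equal or adjacent to all of \<open>C\<close> and belongs to
  \<open>C\<close> by maximality.\<close>

lemma max_clique_eq_closed_nbhd:
  fixes E :: "'n::finite set set"
  assumes "simple_graph E" "homogeneous_chordal E" and C: "C \<in> max_cliques E"
  shows "\<exists>v\<in>C. closed_nbhd E v = C"
proof -
  have clq: "clique E C" and mx: "\<And>D. clique E D \<Longrightarrow> C \<subseteq> D \<Longrightarrow> D = C"
    using C unfolding max_cliques_def by auto
  \<comment> \<open>The vertex type is inhabited, and a singleton is a clique properly containing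
    the empty one.\<close>
  have "C \<noteq> {}"
    using mx[of "{undefined}"] unfolding clique_def by auto
  then have "finite (closed_nbhd E ` C)" "closed_nbhd E ` C \<noteq> {}"
    by auto
  from finite_has_minimal[OF this] obtain v where v: "v \<in> C"
    and vmin: "\<And>w. w \<in> C \<Longrightarrow> closed_nbhd E w \<subseteq> closed_nbhd E v \<Longrightarrow> closed_nbhd E v = closed_nbhd E w"
    by auto
  have sub: "closed_nbhd E v \<subseteq> closed_nbhd E w" if "w \<in> C" for w
  proof (cases "w = v")
    case False
    then have "{v, w} \<in> E"
      using clq v that unfolding clique_def by auto
    from closed_nbhd_nested[OF assms(1,2) this] vmin[OF that] show ?thesis
      by auto
  qed auto
  have "C \<subseteq> closed_nbhd E v"
    using clq v unfolding clique_def closed_nbhd_def by auto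
  moreover have "x \<in> C" if "x \<in> closed_nbhd E v" for x
  proof -
    have "clique E (insert x C)"
      using clq sub that unfolding clique_def closed_nbhd_def
      by (fastforce simp: insert_commute)
    with mx[of "insert x C"] show ?thesis
      by auto
  qed
  ultimately show ?thesis
    using v by blast
qed

text \<open>The chosen vertex \<open>v D\<close> determines \<open>D\<close> as its closed
  neighbourhood, so \<open>v\<close> is injective. If \<open>v D\<close> were in \<open>C\<close>,
  then \<open>C\<close> would lie in that neighbourhood, which is \<open>D\<close>, and maximality
  would give \<open>D = C\<close>. Hence the other maximal cliques inject into the complement of
  \<open>C\<close>.\<close>

lemma card_max_cliques_le:
  fixes E :: "'n::finite set set"
  assumes "simple_graph E" "homogeneous_chordal E" and C: "C \<in> max_cliques E"
  shows "card (max_cliques E) + card C \<le> CARD('n) + 1"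
proof -
  obtain v where v: "\<And>D. D \<in> max_cliques E \<Longrightarrow> v D \<in> D \<and> closed_nbhd E (v D) = D"
    using max_clique_eq_closed_nbhd[OF assms(1,2)] by metis
  have inj: "inj_on v (max_cliques E - {C})"
    using v by (metis DiffD1 inj_onI)
  have "v D \<notin> C" if "D \<in> max_cliques E - {C}" for D
  proof
    assume "v D \<in> C"
    then have "C \<subseteq> closed_nbhd E (v D)"
      using C unfolding max_cliques_def clique_def closed_nbhd_def by auto
    then show False
      using that v C unfolding max_cliques_def by auto
  qed
  then have "card (max_cliques E - {C}) \<le> card (- C)"
    using inj by (intro card_inj_on_le[of v]) auto
  moreover have "card (- C) + card C = CARD('n)"
    by (simp add: Compl_eq_Diff_UNIV card_Diff_subset card_mono)
  moreover have "card (max_cliques E) = Suc (card (max_cliques E - {C}))"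
    using C by (intro card.remove) simp_all
  ultimately show ?thesis
    by linarith
qed

section \<open>The balanced product and the total size of the maximal cliques\<close>

lemma mult_diff_le_ceiling_floor:
  fixes n w :: nat
  shows "int w * (int n + 1 - int w) \<le> \<lceil>(real n + 1) / 2\<rceil> * \<lfloor>(real n + 1) / 2\<rfloor>"
proof -
  obtain k :: int where k: "\<lceil>(real n + 1) / 2\<rceil> = int n + 1 - k" "\<lfloor>(real n + 1) / 2\<rfloor> = k"
    "int n + 1 = 2 * k \<or> int n + 1 = 2 * k + 1"
  proof (cases "even n")
    case True
    then obtain m where "n = 2 * m" by auto
    then have "\<lceil>(real n + 1) / 2\<rceil> = int m + 1" "\<lfloor>(real n + 1) / 2\<rfloor> = int m"
      by (auto simp: ceiling_eq_iff floor_eq_iff)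
    with \<open>n = 2 * m\<close> show ?thesis by (intro that[of "int m"]) auto
  next
    case False
    then obtain m where "n = 2 * m + 1" using oddE by blast
    then have "\<lceil>(real n + 1) / 2\<rceil> = int m + 1" "\<lfloor>(real n + 1) / 2\<rfloor> = int m + 1"
      by (auto simp: ceiling_eq_iff floor_eq_iff)
    with \<open>n = 2 * m + 1\<close> show ?thesis by (intro that[of "int m + 1"]) auto
  qed
  \<comment> \<open>This product equals k(n+1-k) - w(n+1-w). Since k and n+1-k differ by at most 1,
    no integer lies strictly between them, so the two factors never have opposite signs.\<close>
  have "0 \<le> (k - int w) * (int n + 1 - k - int w)"
  proof (cases "int w \<le> k")
    case True
    with k(3) show ?thesis by (intro mult_nonneg_nonneg) linarith+
  next
    case False
    with k(3) show ?thesis by (intro mult_nonpos_nonpos) linarith+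
  qed
  then show ?thesis
    unfolding k(1,2) by (simp add: algebra_simps)
qed

lemma sum_card_max_cliques_le:
  fixes E :: "'n::finite set set"
  assumes "simple_graph E" "homogeneous_chordal E"
  shows "int (\<Sum>C\<in>max_cliques E. card C) \<le>
    \<lceil>(real CARD('n) + 1) / 2\<rceil> * \<lfloor>(real CARD('n) + 1) / 2\<rfloor>"
proof -
  have "max_cliques E \<noteq> {}"
    using clique_subset_max_clique[of E "{}"] by (auto simp: clique_def)
  then obtain C where C: "C \<in> max_cliques E" and "\<And>D. D \<in> max_cliques E \<Longrightarrow> card D \<le> card C"
    using finite_has_maximal[of "card ` max_cliques E"]
    by simp (metis nle_le)
  then have "(\<Sum>D\<in>max_cliques E. card D) \<le> card (max_cliques E) * card C"
    using sum_bounded_above[of "max_cliques E" card "card C"] by simp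
  also have "int \<dots> \<le> int (card C) * (int CARD('n) + 1 - int (card C))"
    using card_max_cliques_le[OF assms C] by (simp add: mult.commute mult_left_mono)
  also have "\<dots> \<le> \<lceil>(real CARD('n) + 1) / 2\<rceil> * \<lfloor>(real CARD('n) + 1) / 2\<rfloor>"
    by (rule mult_diff_le_ceiling_floor)
  finally show ?thesis by simp
qed

section \<open>Polynomial functions of bounded degree\<close>

definition monom_eval :: "('v \<Rightarrow> real) \<Rightarrow> ('v \<Rightarrow>\<^sub>0 nat) \<Rightarrow> real" where
  "monom_eval a m = (\<Prod>v\<in>Poly_Mapping.keys m. a v ^ Poly_Mapping.lookup m v)"

definition monom_degree :: "('v \<Rightarrow>\<^sub>0 nat) \<Rightarrow> nat" where
  "monom_degree m = (\<Sum>v\<in>Poly_Mapping.keys m. Poly_Mapping.lookup m v)"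

text \<open>Closure properties are stated for evaluation functions with a mere upper bound on the
  degree, so cancellation of leading terms is harmless.\<close>

definition poly_fun :: "'v set \<Rightarrow> nat \<Rightarrow> (('v \<Rightarrow> real) \<Rightarrow> real) \<Rightarrow> bool" where
  "poly_fun B d g \<longleftrightarrow>
     (\<exists>p. mpoly_vars p \<subseteq> B \<and> total_degree p \<le> d \<and> (\<forall>a. mpoly_eval a p = g a))"

text \<open>Variables outside the keys have exponent 0 and contribute a factor 1; enlarging the
  index set lets several monomials share one.\<close>

lemma monom_eval_superset:
  assumes "finite S" "Poly_Mapping.keys m \<subseteq> S"
  shows "monom_eval a m = (\<Prod>v\<in>S. a v ^ Poly_Mapping.lookup m v)"
  unfolding monom_eval_def
  by (rule prod.mono_neutral_left) (use assms in \<open>auto simp: in_keys_iff\<close>)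

lemma monom_degree_superset:
  assumes "finite S" "Poly_Mapping.keys m \<subseteq> S"
  shows "monom_degree m = (\<Sum>v\<in>S. Poly_Mapping.lookup m v)"
  unfolding monom_degree_def
  by (rule sum.mono_neutral_left) (use assms in \<open>auto simp: in_keys_iff\<close>)

lemma
  shows monom_eval_add: "monom_eval a (m + n) = monom_eval a m * monom_eval a n"
    and monom_degree_add: "monom_degree (m + n) = monom_degree m + monom_degree n"
proof -
  let ?S = "Poly_Mapping.keys m \<union> Poly_Mapping.keys n"
  have S: "finite ?S" "Poly_Mapping.keys m \<subseteq> ?S" "Poly_Mapping.keys n \<subseteq> ?S"
    "Poly_Mapping.keys (m + n) \<subseteq> ?S"
    by (auto dest: Poly_Mapping.keys_add[THEN subsetD])
  show "monom_eval a (m + n) = monom_eval a m * monom_eval a n"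
    by (simp add: monom_eval_superset[OF S(1)] S lookup_add power_add prod.distrib)
  show "monom_degree (m + n) = monom_degree m + monom_degree n"
    by (simp add: monom_degree_superset[OF S(1)] S lookup_add sum.distrib)
qed

lemma mpoly_eval_superset:
  assumes "finite S" "Poly_Mapping.keys p \<subseteq> S"
  shows "mpoly_eval a p = (\<Sum>m\<in>S. Poly_Mapping.lookup p m * monom_eval a m)"
  unfolding mpoly_eval_def monom_eval_def[symmetric]
  by (rule sum.mono_neutral_left) (use assms in \<open>auto simp: in_keys_iff\<close>)

lemma mpoly_eval_add: "mpoly_eval a (p + q) = mpoly_eval a p + mpoly_eval a q"
proof -
  let ?S = "Poly_Mapping.keys p \<union> Poly_Mapping.keys q"
  have S: "finite ?S" "Poly_Mapping.keys p \<subseteq> ?S" "Poly_Mapping.keys q \<subseteq> ?S"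
    "Poly_Mapping.keys (p + q) \<subseteq> ?S"
    by (auto dest: Poly_Mapping.keys_add[THEN subsetD])
  show ?thesis
    by (simp add: mpoly_eval_superset[OF S(1)] S lookup_add distrib_right sum.distrib)
qed

lemma total_degree_le_iff: "total_degree p \<le> d \<longleftrightarrow> (\<forall>m\<in>Poly_Mapping.keys p. monom_degree m \<le> d)"
  unfolding total_degree_def monom_degree_def by auto

lemma poly_fun_add:
  assumes "poly_fun B d g" "poly_fun B d h"
  shows "poly_fun B d (\<lambda>a. g a + h a)"
proof -
  obtain p q where p: "mpoly_vars p \<subseteq> B" "total_degree p \<le> d" "\<And>a. mpoly_eval a p = g a"
    and q: "mpoly_vars q \<subseteq> B" "total_degree q \<le> d" "\<And>a. mpoly_eval a q = h a"
    using assms unfolding poly_fun_def by blast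
  have "mpoly_vars (p + q) \<subseteq> B" "total_degree (p + q) \<le> d"
    using p q unfolding mpoly_vars_def total_degree_le_iff
    by (blast dest: Poly_Mapping.keys_add[THEN subsetD])+
  then show ?thesis
    unfolding poly_fun_def using p(3) q(3) mpoly_eval_add by metis
qed

lemma poly_fun_monom:
  assumes "Poly_Mapping.keys m \<subseteq> B" "monom_degree m \<le> d"
  shows "poly_fun B d (\<lambda>a. c * monom_eval a m)"
  unfolding poly_fun_def
  by (rule exI[of _ "Poly_Mapping.single m c"])
    (use assms in \<open>auto simp: mpoly_vars_def total_degree_le_iff mpoly_eval_def
      monom_eval_def split: if_splits\<close>)

lemma poly_fun_const: "poly_fun B d (\<lambda>a. c)"
  using poly_fun_monom[of 0 B d c] by (simp add: monom_eval_def monom_degree_def)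

lemma poly_fun_var: "v \<in> B \<Longrightarrow> poly_fun B 1 (\<lambda>a. a v)"
  using poly_fun_monom[of "Poly_Mapping.single v 1" B 1 1]
  by (simp add: monom_eval_def monom_degree_def)

lemma poly_fun_sum:
  "(\<And>i. i \<in> I \<Longrightarrow> poly_fun B d (g i)) \<Longrightarrow> poly_fun B d (\<lambda>a. \<Sum>i\<in>I. g i a)"
  by (induction I rule: infinite_finite_induct) (auto intro: poly_fun_const poly_fun_add)

text \<open>The product of the values is expanded into monomials, each bounded separately, and then
  reassembled by closure under sums.\<close>

lemma poly_fun_mult:
  assumes "poly_fun B d g" "poly_fun B e h"
  shows "poly_fun B (d + e) (\<lambda>a. g a * h a)"
proof -
  obtain p q where p: "mpoly_vars p \<subseteq> B" "total_degree p \<le> d" "\<And>a. mpoly_eval a p = g a"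
    and q: "mpoly_vars q \<subseteq> B" "total_degree q \<le> e" "\<And>a. mpoly_eval a q = h a"
    using assms unfolding poly_fun_def by blast
  let ?c = "\<lambda>m n. Poly_Mapping.lookup p m * Poly_Mapping.lookup q n"
  have "poly_fun B (d + e)
     (\<lambda>a. \<Sum>m\<in>Poly_Mapping.keys p. \<Sum>n\<in>Poly_Mapping.keys q. ?c m n * monom_eval a (m + n))"
  proof (intro poly_fun_sum poly_fun_monom)
    fix m n assume mn: "m \<in> Poly_Mapping.keys p" "n \<in> Poly_Mapping.keys q"
    show "Poly_Mapping.keys (m + n) \<subseteq> B"
      using mn p(1) q(1) Poly_Mapping.keys_add[of m n] unfolding mpoly_vars_def by blast
    show "monom_degree (m + n) \<le> d + e"
      using mn p(2) q(2) unfolding monom_degree_add total_degree_le_iff by (simp add: add_mono)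
  qed
  moreover have "(\<Sum>m\<in>Poly_Mapping.keys p. \<Sum>n\<in>Poly_Mapping.keys q. ?c m n * monom_eval a (m + n))
      = g a * h a" for a
    unfolding p(3)[symmetric] q(3)[symmetric] mpoly_eval_def monom_eval_def[symmetric]
      monom_eval_add sum_product
    by (simp add: mult_ac)
  ultimately show ?thesis by simp
qed

lemma poly_fun_prod:
  "(\<And>i. i \<in> I \<Longrightarrow> poly_fun B (d i) (g i)) \<Longrightarrow> poly_fun B (\<Sum>i\<in>I. d i) (\<lambda>a. \<Prod>i\<in>I. g i a)"
  by (induction I rule: infinite_finite_induct) (auto intro: poly_fun_const poly_fun_mult)

text \<open>Each term of the Leibniz expansion takes one entry from every row, so degree bounds
  given row by row add up. Constant rows cost nothing.\<close>

lemma poly_fun_det: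
  fixes M :: "('v \<Rightarrow> real) \<Rightarrow> real ^ 'n ^ 'n"
  assumes "\<And>i j. poly_fun B (d i) (\<lambda>a. M a $ i $ j)"
  shows "poly_fun B (\<Sum>i\<in>UNIV. d i) (\<lambda>a. det (M a))"
  unfolding det_def
  by (intro poly_fun_sum poly_fun_mult[where d = 0, simplified] poly_fun_const poly_fun_prod assms)

section \<open>The determinant of a principal submatrix\<close>

text \<open>\<open>A\<^sub>C\<close> is completed by an identity block, so that its determinant and its definiteness
  become those of a matrix of fixed size.\<close>

definition pad :: "'n set \<Rightarrow> real ^ 'n ^ 'n \<Rightarrow> real ^ 'n ^ 'n" where
  "pad C A = (\<chi> i j. if i \<in> C \<and> j \<in> C then A $ i $ j else if i = j then 1 else 0)"

lemma pad_mat_1: "pad C (mat 1) = mat 1"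
  by (auto simp: pad_def mat_def vec_eq_iff)

lemma inner_pad:
  fixes A :: "real ^ 'n::finite ^ 'n"
  shows "x \<bullet> (pad C A *v x) =
    (\<Sum>i\<in>C. \<Sum>j\<in>C. x $ i * A $ i $ j * x $ j) + (\<Sum>i\<in>-C. (x $ i)\<^sup>2)"
proof -
  have row: "(pad C A *v x) $ i = (if i \<in> C then (\<Sum>j\<in>C. A $ i $ j * x $ j) else x $ i)" for i
  proof (cases "i \<in> C")
    case True
    have "(\<Sum>j\<in>C. A $ i $ j * x $ j) = (\<Sum>j\<in>UNIV. pad C A $ i $ j * x $ j)"
      using True by (intro sum.mono_neutral_cong_left) (auto simp: pad_def)
    with True show ?thesis
      by (simp add: matrix_vector_mult_def)
  next
    case False
    then have "(\<Sum>j\<in>UNIV. pad C A $ i $ j * x $ j) = (\<Sum>j\<in>{i}. x $ j)"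
      by (intro sum.mono_neutral_cong_right) (auto simp: pad_def)
    with False show ?thesis
      by (simp add: matrix_vector_mult_def)
  qed
  have "x \<bullet> (pad C A *v x) = (\<Sum>i\<in>UNIV. x $ i * (pad C A *v x) $ i)"
    by (simp add: inner_vec_def)
  also have "\<dots> = (\<Sum>i\<in>C. x $ i * (pad C A *v x) $ i) + (\<Sum>i\<in>-C. x $ i * (pad C A *v x) $ i)"
    by (subst sum.union_disjoint[symmetric]) auto
  also have "\<dots> = (\<Sum>i\<in>C. \<Sum>j\<in>C. x $ i * A $ i $ j * x $ j) + (\<Sum>i\<in>-C. (x $ i)\<^sup>2)"
    by (simp add: row sum_distrib_left mult.assoc power2_eq_square)
  finally show ?thesis .
qed

lemma psd_on_iff_pad:
  assumes "transpose A = A"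
  shows "psd_on C A \<longleftrightarrow> (\<forall>x. 0 \<le> x \<bullet> (pad C A *v x))"
proof
  assume "psd_on C A"
  then show "\<forall>x. 0 \<le> x \<bullet> (pad C A *v x)"
    unfolding inner_pad psd_on_def by (simp add: sum_nonneg)
next
  assume *: "\<forall>x. 0 \<le> x \<bullet> (pad C A *v x)"
  have "0 \<le> (\<Sum>i\<in>C. \<Sum>j\<in>C. x i * A $ i $ j * x j)" for x
  proof -
    \<comment> \<open>Cutting the test vector down to \<open>C\<close> removes the squares
      contributed by the identity block.\<close>
    let ?x = "\<chi> i. if i \<in> C then x i else 0"
    have "0 \<le> (\<Sum>i\<in>C. \<Sum>j\<in>C. ?x $ i * A $ i $ j * ?x $ j) + (\<Sum>i\<in>-C. (?x $ i)\<^sup>2)"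
      using * unfolding inner_pad by blast
    then show ?thesis by simp
  qed
  moreover have "A $ i $ j = A $ j $ i" for i j
    using assms by (metis transpose_def vec_lambda_beta)
  ultimately show "psd_on C A"
    unfolding psd_on_def by blast
qed

text \<open>If the form vanished at \<open>x\<close>, moving from \<open>x\<close> along
  \<open>y = M *v x\<close> would change it by a quadratic in the step length with linear
  coefficient 2|y|^2. Nonnegativity then forces \<open>y = 0\<close>, which contradicts
  invertibility.\<close>

lemma psd_det_nonzero_imp_pos_def:
  fixes M :: "real ^ 'n::finite ^ 'n"
  assumes sym: "transpose M = M" and psd: "\<And>x. 0 \<le> x \<bullet> (M *v x)"
    and "det M \<noteq> 0" "x \<noteq> 0"
  shows "0 < x \<bullet> (M *v x)"
proof (rule ccontr)
  assume "\<not> 0 < x \<bullet> (M *v x)"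
  then have 0: "x \<bullet> (M *v x) = 0"
    using psd[of x] by simp
  define y where "y = M *v x"
  define c where "c = y \<bullet> (M *v y)"
  have "x \<bullet> (M *v y) = y \<bullet> y"
    using sym by (metis dot_lmul_matrix transpose_matrix_vector y_def)
  then have expand: "(x + t *\<^sub>R y) \<bullet> (M *v (x + t *\<^sub>R y)) = 2 * t * (y \<bullet> y) + t\<^sup>2 * c" for t
    using 0 by (simp add: y_def[symmetric] c_def
        power2_eq_square algebra_simps)
  have "c \<ge> 0"
    using psd unfolding c_def .
  \<comment> \<open>The minimiser of the quadratic is -|y|^2/c; the denominator \<open>c + 1\<close>
    also covers c = 0 and still gives a negative value unless \<open>y = 0\<close>.\<close>
  define t where "t = - (y \<bullet> y) / (c + 1)"
  have yy: "y \<bullet> y = - t * (c + 1)"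
    using \<open>c \<ge> 0\<close> unfolding t_def by simp
  have "2 * t * (y \<bullet> y) + t\<^sup>2 * c = - (t\<^sup>2 * (c + 2))"
    unfolding yy by (simp add: power2_eq_square algebra_simps)
  moreover have "0 \<le> 2 * t * (y \<bullet> y) + t\<^sup>2 * c"
    unfolding expand[symmetric] by (rule psd)
  ultimately have "t\<^sup>2 * (c + 2) \<le> 0"
    by linarith
  then have "t = 0"
    using \<open>c \<ge> 0\<close> by (auto simp: mult_le_0_iff)
  then have "y = 0"
    using yy by simp
  moreover have "invertible M"
    using \<open>det M \<noteq> 0\<close> by (simp add: invertible_det_nz)
  ultimately show False
    using \<open>x \<noteq> 0\<close> unfolding y_def
    by (metis invertible_def matrix_left_invertible_ker)
qed

section \<open>Positive definiteness as an open condition\<close>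

lemma continuous_inner_pad:
  fixes C :: "'n::finite set"
  shows "continuous_on S (\<lambda>(x, A). x \<bullet> (pad C A *v x))"
  unfolding inner_pad case_prod_beta by (intro continuous_intros)

text \<open>The complement is the projection of a closed set of pairs along the compact unit sphere,
  hence closed.\<close>

lemma open_pos_def_pad:
  fixes C :: "'n::finite set"
  shows "open {A. \<forall>x\<in>sphere 0 1. 0 < x \<bullet> (pad C A *v x)}"
proof -
  have "closed {(x, A). x \<bullet> (pad C A *v x) \<le> 0}"
    unfolding case_prod_beta
    by (intro closed_Collect_le continuous_on_const)
      (use continuous_inner_pad[of UNIV C] in \<open>simp add: case_prod_beta\<close>)
  from closed_compact_projection[OF compact_sphere this, of 0 1]
  have "closed {A. \<exists>x\<in>sphere 0 1. x \<bullet> (pad C A *v x) \<le> 0}"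
    by (simp add: Bex_def)
  then show ?thesis
    unfolding open_closed by (rule back_subst[of closed]) (auto simp: not_less)
qed

lemma pos_def_on_sphere_imp_nonneg:
  fixes M :: "real ^ 'n::finite ^ 'n"
  assumes "\<forall>x\<in>sphere 0 1. 0 < x \<bullet> (M *v x)"
  shows "0 \<le> x \<bullet> (M *v x)"
proof (cases "x = 0")
  case False
  then have "0 < (x /\<^sub>R norm x) \<bullet> (M *v (x /\<^sub>R norm x))"
    by (intro assms[rule_format]) simp
  then show ?thesis
    using False by (simp add: matrix_vector_mult_scaleR zero_less_mult_iff)
qed simp

section \<open>The cone and its boundary\<close>

text \<open>Every clique lies in a maximal one, and semidefiniteness passes to principal
  submatrices, so finitely many conditions of fixed matrix size suffice.\<close>

lemma clique_psd_cone_iff: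
  fixes E :: "'n::finite set set"
  assumes "A \<in> sym_matrices_on E"
  shows "A \<in> clique_psd_cone E \<longleftrightarrow> (\<forall>C\<in>max_cliques E. \<forall>x. 0 \<le> x \<bullet> (pad C A *v x))"
proof -
  have sym: "transpose A = A"
    using assms unfolding sym_matrices_on_def by simp
  have mono: "psd_on C A" if "psd_on D A" "C \<subseteq> D" for C D
    unfolding psd_on_def
  proof (intro conjI ballI allI)
    fix x :: "'n \<Rightarrow> real"
    \<comment> \<open>Extending a test vector by zero turns the form on \<open>D\<close> into the
      form on \<open>C\<close>.\<close>
    let ?x = "\<lambda>i. if i \<in> C then x i else 0"
    have "0 \<le> (\<Sum>i\<in>D. \<Sum>j\<in>D. ?x i * A $ i $ j * ?x j)"
      using that(1) unfolding psd_on_def by (elim conjE allE)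
    also have "\<dots> = (\<Sum>i\<in>C. \<Sum>j\<in>D. ?x i * A $ i $ j * ?x j)"
      by (rule sum.mono_neutral_right) (use that(2) in auto)
    also have "\<dots> = (\<Sum>i\<in>C. \<Sum>j\<in>C. ?x i * A $ i $ j * ?x j)"
      by (intro sum.cong sum.mono_neutral_right) (use that(2) in auto)
    finally show "0 \<le> (\<Sum>i\<in>C. \<Sum>j\<in>C. x i * A $ i $ j * x j)"
      by simp
  next
    fix i j assume "i \<in> C" "j \<in> C"
    then show "A $ i $ j = A $ j $ i"
      using that unfolding psd_on_def by blast
  qed
  have "A \<in> clique_psd_cone E \<longleftrightarrow> (\<forall>C\<in>max_cliques E. psd_on C A)"
  proof
    assume "A \<in> clique_psd_cone E"
    then show "\<forall>C\<in>max_cliques E. psd_on C A"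
      unfolding clique_psd_cone_def max_cliques_def by simp
  next
    assume "\<forall>C\<in>max_cliques E. psd_on C A"
    then have "psd_on C A" if "clique E C" for C
      using clique_subset_max_clique[OF that] mono by blast
    then show "A \<in> clique_psd_cone E"
      using assms unfolding clique_psd_cone_def by blast
  qed
  then show ?thesis
    by (simp add: psd_on_iff_pad[OF sym])
qed

text \<open>Closedness ensures that frontier points belong to the cone. For fixed \<open>x\<close>
  each defining inequality is a closed condition on \<open>A\<close>.\<close>

lemma closed_clique_psd_cone:
  fixes E :: "'n::finite set set"
  assumes "closed (sym_matrices_on E)"
  shows "closed (clique_psd_cone E)"
proof -
  have "clique_psd_cone E =
      sym_matrices_on E \<inter> (\<Inter>C\<in>max_cliques E. \<Inter>x. {A. 0 \<le> x \<bullet> (pad C A *v x)})"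
    using clique_psd_cone_iff[of _ E] by (auto simp: clique_psd_cone_def)
  moreover have "closed {A. 0 \<le> x \<bullet> (pad C A *v x)}" for C :: "'n set" and x
    unfolding inner_pad by (intro closed_Collect_le continuous_intros)
  ultimately show ?thesis
    using assms by (simp add: closed_Int closed_INT)
qed

text \<open>If no determinant vanished at \<open>A\<close>, all padded blocks would be positive
  definite there. This persists nearby, so \<open>A\<close> would be interior relative to the
  ambient space.\<close>

lemma det_pad_eq_0_on_frontier:
  fixes E :: "'n::finite set set"
  assumes "closed (sym_matrices_on E)"
    and A: "A \<in> top_of_set (sym_matrices_on E) frontier_of clique_psd_cone E"
  shows "\<exists>C\<in>max_cliques E. det (pad C A) = 0"
proof (rule ccontr)
  assume nz: "\<not> ?thesis"
  let ?T = "top_of_set (sym_matrices_on E)"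
  have sub: "clique_psd_cone E \<subseteq> sym_matrices_on E"
    unfolding clique_psd_cone_def by auto
  then have "closedin ?T (clique_psd_cone E)"
    using closed_clique_psd_cone[OF assms(1)] by (simp add: closed_subset)
  then have AK: "A \<in> clique_psd_cone E"
    using A by (simp add: frontier_of_def closure_of_closedin)
  have AS: "A \<in> sym_matrices_on E"
    using AK sub by auto
  \<comment> \<open>Openness of \<open>U\<close> rests on there being finitely many maximal cliques.
    \<open>U\<close> is taken among all matrices; only its intersection with the ambient space need
    lie in the cone.\<close>
  define U where "U = (\<Inter>C\<in>max_cliques E. {A. \<forall>x\<in>sphere 0 1. 0 < x \<bullet> (pad C A *v x)})"
  have "open U"
    unfolding U_def by (intro open_INT ballI open_pos_def_pad) simp
  then have "openin ?T (sym_matrices_on E \<inter> U)"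
    by (rule openin_open_Int)
  moreover have "sym_matrices_on E \<inter> U \<subseteq> clique_psd_cone E"
    unfolding U_def
    by (auto simp: clique_psd_cone_iff simp del: mem_sphere_0
        intro!: pos_def_on_sphere_imp_nonneg)
  moreover have "A \<in> U"
  proof -
    have "A $ i $ j = A $ j $ i" for i j
    proof -
      have "transpose A $ j $ i = A $ j $ i"
        using AS unfolding sym_matrices_on_def by simp
      then show ?thesis by (simp add: transpose_def)
    qed
    then have "transpose (pad C A) = pad C A" for C
      by (auto simp: pad_def transpose_def vec_eq_iff)
    then have "0 < x \<bullet> (pad C A *v x)" if "C \<in> max_cliques E" "x \<in> sphere 0 1" for C x
      using AK nz that unfolding clique_psd_cone_iff[OF AS]
      by (intro psd_det_nonzero_imp_pos_def) auto
    then show ?thesis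
      unfolding U_def by blast
  qed
  ultimately have "A \<in> ?T interior_of clique_psd_cone E"
    using AS unfolding interior_of_def by blast
  then show False
    using A by (simp add: frontier_of_def)
qed

section \<open>The vanishing polynomial in coordinates and the final bound\<close>

lemma vanishing_polynomial_exists:
  fixes E :: "'n::finite set set" and B :: "(real ^ 'n ^ 'n) set"
  assumes B: "independent B" "span B = sym_matrices_on E"
  shows "\<exists>p. p \<noteq> 0 \<and> mpoly_vars p \<subseteq> B \<and> vanishes_on_boundary B (clique_psd_cone E) p \<and>
    total_degree p \<le> (\<Sum>C\<in>max_cliques E. card C)"
proof -
  have finB: "finite B"
    using B(1) by (rule independent_imp_finite)
  \<comment> \<open>\<open>X\<close> rebuilds a matrix from its coordinates along \<open>B\<close>;
    its entries are linear in the variables.\<close>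
  define X where "X a = (\<Sum>b\<in>B. a b *\<^sub>R b)" for a :: "real ^ 'n ^ 'n \<Rightarrow> real"
  have X: "X (representation B x) = x" if "x \<in> sym_matrices_on E" for x
    unfolding X_def using that B finB by (intro real_vector.sum_representation_eq) auto
  have entry: "poly_fun B 1 (\<lambda>a. X a $ i $ j)" for i j
    unfolding X_def by (simp, intro poly_fun_sum poly_fun_mult[where e = 0, simplified]
        poly_fun_var[simplified] poly_fun_const)
  \<comment> \<open>Rows in \<open>C\<close> have degree at most 1 and the padded rows are constant,
    so the bound is \<open>card C\<close> rather than the full matrix size.\<close>
  have "poly_fun B (\<Sum>i\<in>UNIV. if i \<in> C then 1 else 0) (\<lambda>a. det (pad C (X a)))" for C
  proof (rule poly_fun_det)
    fix i j
    show "poly_fun B (if i \<in> C then 1 else 0) (\<lambda>a. pad C (X a) $ i $ j)"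
      using entry[of i j]
      by (cases "i \<in> C"; cases "j \<in> C") (simp_all add: pad_def poly_fun_const)
  qed
  then have "poly_fun B (card C) (\<lambda>a. det (pad C (X a)))" for C
    by (simp add: sum.If_cases)
  then have "poly_fun B (\<Sum>C\<in>max_cliques E. card C) (\<lambda>a. \<Prod>C\<in>max_cliques E. det (pad C (X a)))"
    by (intro poly_fun_prod)
  then obtain p where p: "mpoly_vars p \<subseteq> B" "total_degree p \<le> (\<Sum>C\<in>max_cliques E. card C)"
    and eval: "\<And>a. mpoly_eval a p = (\<Prod>C\<in>max_cliques E. det (pad C (X a)))"
    unfolding poly_fun_def by blast
  have "mat 1 \<in> sym_matrices_on E"
    unfolding sym_matrices_on_def by (auto simp: mat_def transpose_def vec_eq_iff)
  then have "mpoly_eval (representation B (mat 1)) p = 1"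
    unfolding eval by (simp add: X pad_mat_1)
  then have "p \<noteq> 0"
    by (auto simp: mpoly_eval_def)
  moreover have "vanishes_on_boundary B (clique_psd_cone E) p"
    unfolding vanishes_on_boundary_def B(2)
  proof
    fix A assume A: "A \<in> top_of_set (sym_matrices_on E) frontier_of clique_psd_cone E"
    then have "A \<in> sym_matrices_on E"
      using frontier_of_subset_topspace by fastforce
    moreover have "closed (sym_matrices_on E)"
      unfolding B(2)[symmetric] by (intro closed_subspace subspace_span)
    ultimately show "mpoly_eval (representation B A) p = 0"
      using det_pad_eq_0_on_frontier[OF _ A] unfolding eval by (simp add: X)
  qed
  ultimately show ?thesis
    using p by blast
qed

theorem theorem4p6:
  fixes E :: "'n::finite set set"
    and B :: "(real ^ 'n ^ 'n) set"
  assumes "simple_graph E"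
    and "homogeneous_chordal E"
    and "independent B" and "span B = sym_matrices_on E"
  shows "(\<exists>p. minimal_polynomial B (clique_psd_cone E) p) \<and>
    (\<forall>p. minimal_polynomial B (clique_psd_cone E) p \<longrightarrow>
       int (total_degree p) \<le>
         \<lceil>(real CARD('n) + 1) / 2\<rceil> * \<lfloor>(real CARD('n) + 1) / 2\<rfloor>)"
proof -
  let ?P = "\<lambda>q. q \<noteq> 0 \<and> mpoly_vars q \<subseteq> B \<and> vanishes_on_boundary B (clique_psd_cone E) q"
  obtain q where q: "?P q" "total_degree q \<le> (\<Sum>C\<in>max_cliques E. card C)"
    using vanishing_polynomial_exists[OF assms(3,4)] by blast
  \<comment> \<open>One vanishing polynomial serves twice: as degrees are natural numbers, its
    existence yields one of least degree, and its own degree bounds that of every minimal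
    polynomial.\<close>
  have "\<exists>p. minimal_polynomial B (clique_psd_cone E) p"
    unfolding minimal_polynomial_def using ex_has_least_nat[of ?P q total_degree, OF q(1)] by blast
  moreover have "int (total_degree p) \<le> \<lceil>(real CARD('n) + 1) / 2\<rceil> * \<lfloor>(real CARD('n) + 1) / 2\<rfloor>"
    if "minimal_polynomial B (clique_psd_cone E) p" for p
  proof -
    have "total_degree p \<le> (\<Sum>C\<in>max_cliques E. card C)"
      using that q unfolding minimal_polynomial_def by (meson order_trans)
    then have "int (total_degree p) \<le> int (\<Sum>C\<in>max_cliques E. card C)"
      by (rule of_nat_mono)
    with sum_card_max_cliques_le[OF assms(1,2)] show ?thesis
      by (rule order_trans[rotated])
  qed
  ultimately show ?thesis
    by blast
qed

end
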